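(* Let $G$ be a finite simple graph with $n=|V(G)|$ vertices, and let $U\subseteq V(G)$ be such that $V=V(G)\setminus U$ is an independent set of $G$. Let $r$ be the size of the largest induced $(U,V)$-matching of $G$. Then $|\mathbf{TRACES}_G(U)|\le n^{r+1}$.
   Context: For $S\subseteq V(G)$, $N(S)$ denotes the set of vertices not in $S$ adjacent to some vertex of $S$. $\mathbf{TRACES}_G(U)=\{N(S)\cap V : S \text{ an independent subset of } U\}$ (the empty set counts as independent). A $(U,V)$-matching is a matching of $G$ all of whose edges have one end in $U$ and the other end in $V$; it is induced if the subgraph of $G$ induced by the set of endpoints of its edges has exactly the edges of the matching. *)

theory Defs
  imports "Graph_Theory.Graph_Theory"
begin

text \<open>
  Finite simple graphs are the locale \<^locale>\<open>graph\<close> of the session Graph_Theory: finite digraphs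
  that are symmetric, loop-free and without parallel arcs. An undirected edge corresponds to a pair
  of opposite arcs; since matchings are counted by undirected edges, these are represented
  below as two-element sets of vertices.
\<close>

definition edges :: "('a, 'b) pre_digraph \<Rightarrow> 'a set set" where
  "edges G = {{u, v} | u v. u \<rightarrow>\<^bsub>G\<^esub> v}"

definition independent_set :: "('a, 'b) pre_digraph \<Rightarrow> 'a set \<Rightarrow> bool" where
  "independent_set G S \<longleftrightarrow> S \<subseteq> verts G \<and> (\<forall>u\<in>S. \<forall>v\<in>S. \<not> u \<rightarrow>\<^bsub>G\<^esub> v)"

definition neighborhood :: "('a, 'b) pre_digraph \<Rightarrow> 'a set \<Rightarrow> 'a set" where
  "neighborhood G S = {v \<in> verts G - S. \<exists>u\<in>S. u \<rightarrow>\<^bsub>G\<^esub> v}"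

definition traces :: "('a, 'b) pre_digraph \<Rightarrow> 'a set \<Rightarrow> 'a set set" where
  "traces G U = {neighborhood G S \<inter> (verts G - U) | S. S \<subseteq> U \<and> independent_set G S}"

definition matching :: "('a, 'b) pre_digraph \<Rightarrow> 'a set set \<Rightarrow> bool" where
  "matching G M \<longleftrightarrow> M \<subseteq> edges G \<and> pairwise disjnt M"

definition matching_between :: "('a, 'b) pre_digraph \<Rightarrow> 'a set \<Rightarrow> 'a set \<Rightarrow> 'a set set \<Rightarrow> bool" where
  "matching_between G U V M \<longleftrightarrow> matching G M \<and> (\<forall>e\<in>M. \<exists>u\<in>U. \<exists>v\<in>V. e = {u, v})"

definition induced_matching_between :: "('a, 'b) pre_digraph \<Rightarrow> 'a set \<Rightarrow> 'a set \<Rightarrow> 'a set set \<Rightarrow> bool" where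
  "induced_matching_between G U V M \<longleftrightarrow> matching_between G U V M \<and> edges (G \<restriction> \<Union>M) = M"

definition max_induced_matching_size :: "('a, 'b) pre_digraph \<Rightarrow> 'a set \<Rightarrow> 'a set \<Rightarrow> nat" where
  "max_induced_matching_size G U V = Max (card ` {M. induced_matching_between G U V M})"

text \<open>The maximum above is over a finite nonempty set.\<close>

lemma finite_induced_matchings:
  assumes "graph G"
  shows "finite {M. induced_matching_between G U V M}"
proof -
  interpret graph G by (fact assms)
  have "edges G \<subseteq> Pow (verts G)"
    by (auto simp: edges_def dest: adj_in_verts)
  then have "finite (edges G)"
    by (rule finite_subset) simp
  moreover have "{M. induced_matching_between G U V M} \<subseteq> Pow (edges G)"
    by (auto simp: induced_matching_between_def matching_between_def matching_def)
  ultimately show ?thesis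
    by (meson finite_Pow_iff finite_subset)
qed

lemma induced_matching_between_empty: "induced_matching_between G U V {}"
  by (auto simp: induced_matching_between_def matching_between_def matching_def edges_def
      arcs_ends_def)

end

(*
  Shrink an independent set S to a minimal S' with the same trace on V. By minimality every vertex
  of S' has a private neighbour in V, and as S' and V are both independent, matching the vertices
  of S' to their private neighbours gives an induced (U,V)-matching. Hence every trace comes from
  a subset of U with at most r elements, and there are at most (|U| + 1)^r of those.
*)
theory Submission
  imports Defs
begin

text \<open>Termwise comparison with the binomial expansion of (m + 1)^r: each m choose i is at most
  m^i, and the coefficient r choose i is at least 1 for i \<le> r. No relation between m and r is
  assumed.\<close>

lemma sum_binomial_le_power: "(\<Sum>i\<le>r. m choose i) \<le> Suc m ^ r"
proof -
  have "(m choose i) \<le> (r choose i) * m ^ i" if "i \<le> r" for i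
  proof -
    have "(m choose i) \<le> m ^ i"
      by (cases "i \<le> m") (simp_all add: binomial_le_pow binomial_eq_0)
    moreover have "1 \<le> r choose i"
      using that by (simp add: Suc_leI)
    ultimately show ?thesis
      by (metis mult_le_mono mult_1)
  qed
  then have "(\<Sum>i\<le>r. m choose i) \<le> (\<Sum>i\<le>r. (r choose i) * m ^ i)"
    by (intro sum_mono) auto
  also have "\<dots> = Suc m ^ r"
    using binomial[of m 1 r] by simp
  finally show ?thesis .
qed

lemma card_bounded_subsets_le:
  assumes "finite A"
  shows "card {S. S \<subseteq> A \<and> card S \<le> r} \<le> Suc (card A) ^ r"
proof -
  have "{S. S \<subseteq> A \<and> card S \<le> r} = (\<Union>i\<le>r. {S. S \<subseteq> A \<and> card S = i})"
    by auto
  then have "card {S. S \<subseteq> A \<and> card S \<le> r} \<le> (\<Sum>i\<le>r. card {S. S \<subseteq> A \<and> card S = i})"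
    by (simp add: card_UN_le)
  also have "\<dots> \<le> Suc (card A) ^ r"
    using sum_binomial_le_power by (simp add: n_subsets[OF assms])
  finally show ?thesis .
qed

lemma induce_subgraph_adj_iff:
  "u \<rightarrow>\<^bsub>G \<restriction> X\<^esub> v \<longleftrightarrow> u \<in> X \<and> v \<in> X \<and> u \<rightarrow>\<^bsub>G\<^esub> v"
  by (auto simp: arcs_ends_def arc_to_ends_def induce_subgraph_def)

text \<open>Independence of \<open>A\<close> and \<open>B\<close> leaves only edges across, and
  privacy forces a cross edge from \<open>s\<close> to \<open>p t\<close> to have
  \<open>s = t\<close>. The injectivity claim lets the size of the matching be read off as that of
  \<open>S\<close>.\<close>

lemma (in graph) induced_matching_of_private_neighbours:
  assumes "independent_set G A" and "independent_set G B" and "A \<inter> B = {}"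
    and S: "S \<subseteq> A"
    and p: "\<And>s. s \<in> S \<Longrightarrow> p s \<in> B \<and> s \<rightarrow>\<^bsub>G\<^esub> p s"
    and unique: "\<And>s t. s \<in> S \<Longrightarrow> t \<in> S \<Longrightarrow> t \<rightarrow>\<^bsub>G\<^esub> p s \<Longrightarrow> t = s"
  shows "induced_matching_between G A B ((\<lambda>s. {s, p s}) ` S)"
    and "inj_on (\<lambda>s. {s, p s}) S"
proof -
  let ?M = "(\<lambda>s. {s, p s}) ` S"
  have A: "\<not> u \<rightarrow>\<^bsub>G\<^esub> v" if "u \<in> A" "v \<in> A" for u v
    using assms(1) that by (auto simp: independent_set_def)
  have B: "\<not> u \<rightarrow>\<^bsub>G\<^esub> v" if "u \<in> B" "v \<in> B" for u v
    using assms(2) that by (auto simp: independent_set_def)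
  have disj: "s \<noteq> p t" if "s \<in> S" "t \<in> S" for s t
    using p[OF that(2)] that S assms(3) by blast
  have p_inj: "s = t" if "s \<in> S" "t \<in> S" "p s = p t" for s t
    using p[of s] unique[of t s] that by auto
  show "inj_on (\<lambda>s. {s, p s}) S"
    using disj by (auto simp: inj_on_def doubleton_eq_iff)
  have "?M \<subseteq> edges G"
    using p by (auto simp: edges_def)
  moreover have "pairwise disjnt ?M"
  proof -
    have "disjnt {s, p s} {t, p t}" if "s \<in> S" "t \<in> S" "s \<noteq> t" for s t
      using that disj[of s t] disj[of t s] p_inj[of s t] by (auto simp: disjnt_def)
    then show ?thesis
      unfolding pairwise_def by blast
  qed
  moreover have "\<forall>e\<in>?M. \<exists>u\<in>A. \<exists>v\<in>B. e = {u, v}"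
    using S p by auto
  moreover have "edges (G \<restriction> \<Union>?M) = ?M"
  proof
    show "?M \<subseteq> edges (G \<restriction> \<Union>?M)"
      using p by (fastforce simp: edges_def induce_subgraph_adj_iff)
    show "edges (G \<restriction> \<Union>?M) \<subseteq> ?M"
    proof
      fix e assume "e \<in> edges (G \<restriction> \<Union>?M)"
      then obtain u v where e: "e = {u, v}" and u: "u \<in> \<Union>?M" and v: "v \<in> \<Union>?M"
        and uv: "u \<rightarrow>\<^bsub>G\<^esub> v"
        by (auto simp: edges_def induce_subgraph_adj_iff)
      \<comment> \<open>\<open>unique\<close> speaks only of arcs into a private neighbour, so the
        case \<open>u = p s\<close> needs the reversed arc.\<close>
      have vu: "v \<rightarrow>\<^bsub>G\<^esub> u"
        using uv by (rule graph_symmetric)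
      obtain s where s: "s \<in> S" "u = s \<or> u = p s" using u by blast
      obtain t where t: "t \<in> S" "v = t \<or> v = p t" using v by blast
      consider "u = s" "v = p t" | "u = p s" "v = t"
        using s t uv A[of s t] B[of "p s" "p t"] p S by blast
      then show "e \<in> ?M"
        using unique[of t s] unique[of s t] s(1) t(1) uv vu e by cases auto
    qed
  qed
  ultimately show "induced_matching_between G A B ?M"
    by (simp add: induced_matching_between_def matching_between_def matching_def)
qed

lemma induced_matching_between_mono:
  "induced_matching_between G A B M \<Longrightarrow> A \<subseteq> A' \<Longrightarrow> induced_matching_between G A' B M"
  unfolding induced_matching_between_def matching_between_def by (meson subset_eq)

lemma trace_generated_by_small_set:
  assumes "graph G" and U: "U \<subseteq> verts G" and V: "independent_set G (verts G - U)"
    and "T \<in> traces G U"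
  obtains S where "S \<subseteq> U" and "card S \<le> max_induced_matching_size G U (verts G - U)"
    and "T = neighborhood G S \<inter> (verts G - U)"
proof -
  interpret graph G by (fact assms)
  let ?V = "verts G - U"
  let ?P = "\<lambda>S. S \<subseteq> U \<and> independent_set G S \<and> T = neighborhood G S \<inter> ?V"
  obtain S0 where "?P S0"
    using assms(4) by (auto simp: traces_def)
  \<comment> \<open>A representative of least cardinality: deleting any single vertex must destroy
    the trace.\<close>
  then obtain S where S: "S \<subseteq> U" "independent_set G S" "T = neighborhood G S \<inter> ?V"
    and min: "\<And>S'. ?P S' \<Longrightarrow> card S \<le> card S'"
    using ex_has_least_nat[of ?P S0 card] by blast
  have finS: "finite S"
    using finite_subset[OF S(1) finite_subset[OF U]] by simp
  \<comment> \<open>Within the complement of \<open>U\<close>, the condition of lying outside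
    \<open>X\<close> is automatic, so this part of the neighbourhood is monotone in
    \<open>X\<close>.\<close>
  have nb: "neighborhood G X \<inter> ?V = {v \<in> ?V. \<exists>u\<in>X. u \<rightarrow>\<^bsub>G\<^esub> v}" if "X \<subseteq> U" for X
    using that by (auto simp: neighborhood_def)
  have "\<exists>v. v \<in> ?V \<and> s \<rightarrow>\<^bsub>G\<^esub> v \<and> (\<forall>t\<in>S. t \<rightarrow>\<^bsub>G\<^esub> v \<longrightarrow> t = s)" if s: "s \<in> S" for s
  proof (rule ccontr)
    assume no_private: "\<not> ?thesis"
    have sub: "S - {s} \<subseteq> U"
      using S(1) by blast
    \<comment> \<open>Without a private neighbour of \<open>s\<close>, each vertex of the trace
      adjacent to \<open>s\<close> is also adjacent to another vertex of \<open>S\<close>.\<close>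
    have "neighborhood G (S - {s}) \<inter> ?V = T"
      unfolding S(3) nb[OF S(1)] nb[OF sub] using no_private by blast
    moreover have "independent_set G (S - {s})"
      using S(2) by (auto simp: independent_set_def)
    ultimately have "card S \<le> card (S - {s})"
      using min sub by blast
    then show False
      using card_Diff1_less[OF finS s] by simp
  qed
  then obtain p where p: "\<And>s. s \<in> S \<Longrightarrow> p s \<in> ?V \<and> s \<rightarrow>\<^bsub>G\<^esub> p s"
    and unique: "\<And>s t. s \<in> S \<Longrightarrow> t \<in> S \<Longrightarrow> t \<rightarrow>\<^bsub>G\<^esub> p s \<Longrightarrow> t = s"
    by metis
  let ?M = "(\<lambda>s. {s, p s}) ` S"
  have "S \<inter> ?V = {}"
    using S(1) by blast
  \<comment> \<open>One side is taken to be \<open>S\<close> itself, since \<open>U\<close> may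
    contain edges; the side is enlarged to \<open>U\<close> afterwards.\<close>
  note M = induced_matching_of_private_neighbours[OF S(2) V this order_refl p unique]
  have "induced_matching_between G U ?V ?M"
    using M(1) S(1) by (rule induced_matching_between_mono)
  then have "card ?M \<le> max_induced_matching_size G U ?V"
    unfolding max_induced_matching_size_def
    by (intro Max_ge finite_imageI finite_induced_matchings assms(1) imageI) simp
  moreover have "card ?M = card S"
    using M(2) by (rule card_image)
  ultimately show thesis
    using that S by simp
qed

theorem theorem1:
  fixes G :: "('a, 'b) pre_digraph" and U V :: "'a set" and n r :: nat
  assumes "graph G"
    and "verts G \<noteq> {}"
    and "n = card (verts G)"
    and "U \<subseteq> verts G"
    and "V = verts G - U"
    and "independent_set G V"
    and "r = max_induced_matching_size G U V"
  shows "card (traces G U) \<le> n ^ (r + 1)"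
proof -
  interpret graph G by (fact assms)
  \<comment> \<open>The empty graph has one trace, the empty set, whereas 0^(r + 1) = 0.\<close>
  have n: "1 \<le> n"
    using assms(2,3) by (simp add: Suc_le_eq card_gt_0_iff)
  show ?thesis
  \<comment> \<open>If \<open>V\<close> is empty then \<open>U\<close> has n elements, and the base
    \<open>Suc (card U)\<close> would exceed n; but then the only possible trace is the empty
    set.\<close>
  proof (cases "V = {}")
    case True
    then have "traces G U \<subseteq> {{}}"
      using assms(5) by (auto simp: traces_def)
    then have "card (traces G U) \<le> 1"
      using card_mono[of "{{}}" "traces G U"] by simp
    then show ?thesis
      using n one_le_power[of n "r + 1"] by linarith
  next
    case False
    have finU: "finite U"
      using assms(4) finite_verts by (rule finite_subset)
    have "U \<subset> verts G"
      using False assms(4,5) by blast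
    then have U: "Suc (card U) \<le> n"
      unfolding assms(3) by (intro Suc_leI psubset_card_mono) simp_all
    let ?F = "{S. S \<subseteq> U \<and> card S \<le> r}"
    have "traces G U \<subseteq> (\<lambda>S. neighborhood G S \<inter> V) ` ?F"
    proof
      fix T assume "T \<in> traces G U"
      then obtain S where "S \<subseteq> U" "card S \<le> r" "T = neighborhood G S \<inter> V"
        using trace_generated_by_small_set[OF assms(1,4)] assms(6) unfolding assms(5,7) by metis
      then show "T \<in> (\<lambda>S. neighborhood G S \<inter> V) ` ?F"
        by blast
    qed
    then have "card (traces G U) \<le> card ?F"
      using finU by (intro surj_card_le) simp_all
    also have "\<dots> \<le> Suc (card U) ^ r"
      using finU by (rule card_bounded_subsets_le)
    also have "\<dots> \<le> n ^ r"
      using U by (rule power_mono) simp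
    also have "\<dots> \<le> n ^ (r + 1)"
      using n by (intro power_increasing) simp_all
    finally show ?thesis .
  qed
qed

end
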